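(* Let $A$ be an $n\times n$ nonsingular integer matrix. Then the algebraic entropy of the (projective) monomial map from $\mathbb{CP}^n$ to itself associated with $A$ is equal to the logarithm of the spectral radius of $A$.
   Context: Monomial maps. A nonsingular integer matrix $A=(a_{ij})_{i,j=1}^n$ determines the affine monomial map $(x_1,\dots,x_n)\mapsto(y_1,\dots,y_n)$, $y_i=\prod_j x_j^{a_{ij}}$, on a dense open subset of $\mathbb C^n$. The monomial map $f$ from $\mathbb{CP}^n$ to itself associated with $A$ is its projectivization, obtained from $(x_1:\dots:x_{n+1})\mapsto(y_1:\dots:y_n:1)$ with $y_i=\prod_j (x_j/x_{n+1})^{a_{ij}}$ by clearing denominators and removing common factors. Degree. Every rational map from $\mathbb{CP}^n$ to itself can be written as $(x_1:\dots:x_{n+1})\mapsto(p_1:\dots:p_{n+1})$ with $p_1,\dots,p_{n+1}$ homogeneous polynomials of the same degree with no joint common factor. This common degree is the degree $\deg(f)$ of the map. Rational maps agreeing on a Zariski-dense set are identified, and $f^N$ denotes the $N$-fold composition of $f$, again written with common factors removed (so that for the monomial map associated with $A$, $f^N$ is the monomial map associated with $A^N$). Algebraic entropy. The algebraic entropy of $f$ is $\lim_{N\to\infty}\frac1N\log\deg(f^N)$ (the limit exists because $\deg(f\circ g)\le\deg(f)\deg(g)$). The spectral radius of $A$ is the maximum of $|z|$ over all eigenvalues $z\in\mathbb C$ of $A$. *)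

theory Defs
  imports
    Complex_Main
    "HOL-Library.Poly_Mapping"
    "Jordan_Normal_Form.Spectral_Radius"
begin

text \<open>Multivariate polynomials over the complex numbers are finitely supported maps from
  exponent vectors to coefficients; multiplication in \<^theory>\<open>HOL-Library.Poly_Mapping\<close> is
  convolution. On projective \<open>n\<close>-space only the variables \<open>0, \<dots>, n\<close> occur: variable \<open>k\<close> is the
  homogeneous coordinate usually called \<open>x\<^sub>k\<^sub>+\<^sub>1\<close>, so \<open>n\<close> is the coordinate at infinity.\<close>

type_synonym cpoly = "(nat \<Rightarrow>\<^sub>0 nat) \<Rightarrow>\<^sub>0 complex"

definition const_poly :: "complex \<Rightarrow> cpoly" where
  "const_poly c = Poly_Mapping.single 0 c"

definition var_poly :: "nat \<Rightarrow> cpoly" where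
  "var_poly k = Poly_Mapping.single (Poly_Mapping.single k 1) 1"

definition subst_poly :: "(nat \<Rightarrow> cpoly) \<Rightarrow> cpoly \<Rightarrow> cpoly" where
  "subst_poly g p = (\<Sum>m\<in>Poly_Mapping.keys p.
     const_poly (Poly_Mapping.lookup p m) *
     (\<Prod>k\<in>Poly_Mapping.keys m. g k ^ Poly_Mapping.lookup m k))"

definition homogeneous :: "nat \<Rightarrow> nat \<Rightarrow> cpoly \<Rightarrow> bool" where
  "homogeneous n d p \<longleftrightarrow> (\<forall>m\<in>Poly_Mapping.keys p.
     Poly_Mapping.keys m \<subseteq> {..n} \<and> (\<Sum>k\<le>n. Poly_Mapping.lookup m k) = d)"

text \<open>A rational map from projective \<open>n\<close>-space to itself is given by a tuple \<open>f 0, \<dots>, f n\<close> of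
  homogeneous polynomials of one degree, not all zero; the values of \<open>f\<close> at indices above \<open>n\<close>
  are never used. Two such tuples agree on a Zariski-dense set iff they are proportional over
  the field of rational functions.\<close>

definition rat_map_tuple :: "nat \<Rightarrow> nat \<Rightarrow> (nat \<Rightarrow> cpoly) \<Rightarrow> bool" where
  "rat_map_tuple n d f \<longleftrightarrow> (\<forall>i\<le>n. homogeneous n d (f i)) \<and> (\<exists>i\<le>n. f i \<noteq> 0)"

definition same_rat_map :: "nat \<Rightarrow> (nat \<Rightarrow> cpoly) \<Rightarrow> (nat \<Rightarrow> cpoly) \<Rightarrow> bool" where
  "same_rat_map n f g \<longleftrightarrow> (\<forall>i\<le>n. \<forall>j\<le>n. f i * g j = f j * g i)"

text \<open>The common factor \<open>h\<close> may be taken from the polynomial ring in all variables: a divisor of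
  a nonzero polynomial in the variables \<open>0, \<dots>, n\<close> contains only these variables.\<close>

definition no_common_factor :: "nat \<Rightarrow> (nat \<Rightarrow> cpoly) \<Rightarrow> bool" where
  "no_common_factor n f \<longleftrightarrow> (\<forall>h. (\<forall>i\<le>n. h dvd f i) \<longrightarrow> h dvd 1)"

text \<open>\<open>f\<close> itself may have common factors; the degree is read off from the tuple without common
  factors that represents the same map. It is meaningful if \<open>f\<close> is not the zero tuple.\<close>

definition rat_map_degree :: "nat \<Rightarrow> (nat \<Rightarrow> cpoly) \<Rightarrow> nat" where
  "rat_map_degree n f =
     (THE d. \<exists>p. rat_map_tuple n d p \<and> no_common_factor n p \<and> same_rat_map n f p)"

definition rat_map_comp :: "(nat \<Rightarrow> cpoly) \<Rightarrow> (nat \<Rightarrow> cpoly) \<Rightarrow> (nat \<Rightarrow> cpoly)" where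
  "rat_map_comp f g = (\<lambda>i. subst_poly g (f i))"

primrec rat_map_iterate :: "(nat \<Rightarrow> cpoly) \<Rightarrow> nat \<Rightarrow> (nat \<Rightarrow> cpoly)" where
  "rat_map_iterate f 0 = var_poly"
| "rat_map_iterate f (Suc N) = rat_map_comp f (rat_map_iterate f N)"

definition entropy_seq :: "nat \<Rightarrow> (nat \<Rightarrow> cpoly) \<Rightarrow> nat \<Rightarrow> real" where
  "entropy_seq n f N = 1 / real N * ln (real (rat_map_degree n (rat_map_iterate f N)))"

definition algebraic_entropy :: "nat \<Rightarrow> (nat \<Rightarrow> cpoly) \<Rightarrow> real" where
  "algebraic_entropy n f = lim (entropy_seq n f)"

text \<open>Exponent of the variable \<open>k\<close> in the \<open>i\<close>-th coordinate of \<open>(y\<^sub>1 : \<dots> : y\<^sub>n : 1)\<close>, where \<open>y\<^sub>i\<close> is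
  the product of the powers \<open>(x\<^sub>j / x\<^sub>n\<^sub>+\<^sub>1)\<close> to the \<open>a\<^sub>i\<^sub>j\<close>.\<close>

definition laurent_exponent :: "nat \<Rightarrow> int mat \<Rightarrow> nat \<Rightarrow> nat \<Rightarrow> int" where
  "laurent_exponent n A i k =
     (if i = n then 0
      else if k = n then - (\<Sum>j<n. A $$ (i, j))
      else A $$ (i, k))"

text \<open>Subtracting, for each variable, its least exponent among the \<open>n + 1\<close> coordinates both clears
  the denominators and removes the common monomial factors.\<close>

definition monomial_map :: "nat \<Rightarrow> int mat \<Rightarrow> (nat \<Rightarrow> cpoly)" where
  "monomial_map n A = (\<lambda>i. \<Prod>k\<le>n. var_poly k ^
     nat (laurent_exponent n A i k - Min ((\<lambda>l. laurent_exponent n A l k) ` {..n})))"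

lemma var_poly_power: "var_poly k ^ e = Poly_Mapping.single (Poly_Mapping.single k e) 1"
  by (induction e) (auto simp: var_poly_def mult_single single_add[symmetric])

lemma prod_var_poly: "finite K \<Longrightarrow> (\<Prod>k\<in>K. var_poly k ^ e k) = Poly_Mapping.single (\<Sum>k\<in>K. Poly_Mapping.single k (e k)) 1"
  by (induction K rule: finite_induct) (auto simp: var_poly_power mult_single)

lemma lookup_sum_single: "finite K \<Longrightarrow> Poly_Mapping.lookup (\<Sum>k\<in>K. Poly_Mapping.single k (e k :: nat)) j = (if j \<in> K then e j else 0)"
  by (simp add: lookup_sum lookup_single when_def)

lemma const_poly_mult: "const_poly a * const_poly b = const_poly (a*b)"
  by (simp add: const_poly_def mult_single)
lemma const_poly_1: "const_poly 1 = 1" by (simp add: const_poly_def)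
lemma const_poly_power: "const_poly a ^ e = const_poly (a^e)"
  by (induction e) (auto simp: const_poly_mult const_poly_1)
lemma const_poly_prod: "(\<Prod>k\<in>K. const_poly (f k)) = const_poly (prod f K)"
  by (induction K rule: infinite_finite_induct) (auto simp: const_poly_mult const_poly_1)

lemma subst_poly_prod_var: "finite K \<Longrightarrow> subst_poly g (\<Prod>k\<in>K. var_poly k ^ e k) = (\<Prod>k\<in>K. g k ^ e k)"
proof -
  assume K: "finite K"
  let ?m = "\<Sum>k\<in>K. Poly_Mapping.single k (e k)"
  have "subst_poly g (\<Prod>k\<in>K. var_poly k ^ e k) = (\<Prod>k\<in>Poly_Mapping.keys ?m. g k ^ Poly_Mapping.lookup ?m k)"
    by (simp add: subst_poly_def prod_var_poly[OF K] const_poly_1)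
  also have "\<dots> = (\<Prod>k\<in>K. g k ^ e k)"
    by (rule prod.mono_neutral_cong_left) (auto simp: K lookup_sum_single in_keys_iff split: if_splits)
  finally show ?thesis .
qed

text \<open>Where no coordinate vanishes, the monomial map takes \<open>(x\<^sub>1 : \<dots> : x\<^sub>n\<^sub>+\<^sub>1)\<close> to
  \<open>(y\<^sub>1 : \<dots> : y\<^sub>n : 1)\<close>; evaluation is substitution of constant polynomials.\<close>

lemma monomial_map_torus:
  assumes "\<And>k. k \<le> n \<Longrightarrow> x k \<noteq> 0"
  shows "\<exists>c. c \<noteq> 0 \<and> (\<forall>i\<le>n. subst_poly (\<lambda>k. const_poly (x k)) (monomial_map n A i) =
     const_poly (c * (if i = n then 1 else \<Prod>j<n. (x j / x n) powi (A $$ (i,j)))))"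
proof -
  define M where "M k = Min ((\<lambda>l. laurent_exponent n A l k) ` {..n})" for k
  define c where "c = (\<Prod>k\<le>n. x k powi (- M k))"
  have c: "c \<noteq> 0" using assms by (auto simp: c_def)
  have "subst_poly (\<lambda>k. const_poly (x k)) (monomial_map n A i) =
     const_poly (c * (if i = n then 1 else \<Prod>j<n. (x j / x n) powi (A $$ (i,j))))" if i: "i \<le> n" for i
  proof -
    let ?L = "laurent_exponent n A i"
    have M: "M k \<le> ?L k" for k unfolding M_def using i by (intro Min_le) auto
    have "(\<Prod>k\<le>n. x k ^ nat (?L k - M k)) = (\<Prod>k\<le>n. x k powi (- M k) * x k powi ?L k)"
    proof (rule prod.cong[OF refl])
      fix k assume "k \<in> {..n}"
      then have "x k \<noteq> 0" using assms by auto
      have "x k ^ nat (?L k - M k) = x k powi (?L k - M k)" using M[of k] by (simp add: power_int_def)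
      also have "\<dots> = x k powi (- M k) * x k powi ?L k"
        using \<open>x k \<noteq> 0\<close> by (simp add: power_int_add[symmetric])
      finally show "x k ^ nat (?L k - M k) = x k powi (- M k) * x k powi ?L k" .
    qed
    also have "\<dots> = c * (\<Prod>k\<le>n. x k powi ?L k)" by (simp add: c_def prod.distrib)
    also have "(\<Prod>k\<le>n. x k powi ?L k) = (if i = n then 1 else \<Prod>j<n. (x j / x n) powi (A $$ (i,j)))"
    proof (cases "i = n")
      case True then show ?thesis by (simp add: laurent_exponent_def)
    next
      case False
      have P: "(\<Prod>j\<in>J. x n powi f j) = x n powi (sum f J)" for J :: "nat set" and f
        by (induction J rule: infinite_finite_induct) (auto simp: power_int_add assms)
      have "(\<Prod>k\<le>n. x k powi ?L k) = (\<Prod>k<n. x k powi ?L k) * x n powi ?L n"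
        by (simp add: lessThan_Suc_atMost[symmetric])
      also have "\<dots> = (\<Prod>k<n. x k powi (A $$ (i,k))) * x n powi (- (\<Sum>j<n. A $$ (i,j)))"
        using False by (simp add: laurent_exponent_def)
      also have "\<dots> = (\<Prod>j<n. (x j / x n) powi (A $$ (i,j)))"
        by (simp add: power_int_divide_distrib prod_dividef P power_int_minus field_simps)
      finally show ?thesis using False by simp
    qed
    finally show ?thesis
      by (simp add: monomial_map_def subst_poly_prod_var const_poly_power const_poly_prod M_def[symmetric])
  qed
  with c show ?thesis by blast
qed

end

theory Submission
  imports Defs
begin

text \<open>The degree of a monomial map is, up to constant factors, the largest modulus of an entry of its
  matrix. Indeed the coordinates of \<open>(y\<^sub>1 : \<dots> : y\<^sub>n : 1)\<close> are Laurent monomials of total degree zero.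
  Clearing denominators and common factors subtracts from the exponents of each variable their
  minimum, so that the degree is minus the sum of these minima. This is at most a multiple of the
  largest entry. Conversely, a negative entry is bounded by the corresponding minimum, and a positive
  one is balanced by the negative exponents in its row, as the row sums to zero
  (\<open>monomial_map_degree_le\<close>, \<open>abs_laurent_exponent_le_degree\<close>).

  Iterating the map takes powers of the matrix (\<open>monomial_map_iterate\<close>), so the entropy is the
  exponential growth rate of the largest entry of the powers of \<open>A\<close>. By Gelfand's formula
  this is the logarithm of the spectral radius: an eigenvector gives the lower bound
  (\<open>spectral_radius_pow_le\<close>), the Jordan normal form the upper one (\<open>norm_bound_pow_mat\<close>).
  Nonsingularity makes the spectral radius positive, so that its logarithm is the limit of the
  logarithms.

  The remaining point is algebraic: the degree of a rational map is that of any
  representing tuple without common factors, so the degree of the monomial tuple must be shown not to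
  depend on the choice of representative (\<open>rat_map_degree_monomials\<close>). This rests on the fact that
  monomials have only monomials as divisors, up to constants.\<close>

section \<open>Monomials and their divisors\<close>

definition monomial :: "nat \<Rightarrow> (nat \<Rightarrow> nat) \<Rightarrow> cpoly" where
  "monomial n e = (\<Prod>k\<le>n. var_poly k ^ e k)"

lemma monomial_cong: "(\<And>k. k \<le> n \<Longrightarrow> e k = e' k) \<Longrightarrow> monomial n e = monomial n e'"
  by (simp add: monomial_def)

definition exponent_vector :: "nat \<Rightarrow> (nat \<Rightarrow> nat) \<Rightarrow> nat \<Rightarrow>\<^sub>0 nat" where
  "exponent_vector n e = (\<Sum>k\<le>n. Poly_Mapping.single k (e k))"

lemma lookup_exponent_vector:
  "Poly_Mapping.lookup (exponent_vector n e) k = (if k \<le> n then e k else 0)"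
  by (simp add: exponent_vector_def lookup_sum_single)

lemma monomial_eq_single: "monomial n e = Poly_Mapping.single (exponent_vector n e) 1"
  by (simp add: monomial_def exponent_vector_def prod_var_poly)

lemma monomial_nonzero: "monomial n e \<noteq> 0"
  unfolding monomial_eq_single by (metis lookup_single_eq lookup_zero zero_neq_one)

lemma monomial_mult: "monomial n e * monomial n e' = monomial n (\<lambda>k. e k + e' k)"
  by (simp add: monomial_def power_add prod.distrib)

lemma homogeneous_monomial:
  assumes "(\<Sum>k\<le>n. e k) = d"
  shows "homogeneous n d (monomial n e)"
proof -
  have "Poly_Mapping.keys (exponent_vector n e) \<subseteq> {..n}"
    by (auto simp: in_keys_iff lookup_exponent_vector split: if_splits)
  then show ?thesis
    using assms by (simp add: homogeneous_def monomial_eq_single lookup_exponent_vector)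
qed

text \<open>If the exponent \<open>a + b\<close> arises from the supports of the factors in one way only, no other
  pair of terms can contribute to, or cancel, its coefficient in the product.\<close>

lemma lookup_mult_unique_sum:
  fixes f g :: cpoly
  assumes "\<And>a' b'. a' \<in> Poly_Mapping.keys f \<Longrightarrow> b' \<in> Poly_Mapping.keys g \<Longrightarrow> a' + b' = a + b \<Longrightarrow> a' = a"
  shows "Poly_Mapping.lookup (f * g) (a + b) = Poly_Mapping.lookup f a * Poly_Mapping.lookup g b"
proof -
  define f' where "f' = f - Poly_Mapping.single a (Poly_Mapping.lookup f a)"
  define g' where "g' = g - Poly_Mapping.single b (Poly_Mapping.lookup g b)"
  have f': "Poly_Mapping.keys f' \<subseteq> Poly_Mapping.keys f - {a}"
    by (auto simp: f'_def in_keys_iff lookup_minus lookup_single when_def split: if_splits)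
  have g': "b \<notin> Poly_Mapping.keys g'"
    by (simp add: g'_def in_keys_iff lookup_minus)
  have "a + b \<notin> Poly_Mapping.keys (f' * g)"
    using keys_mult[of f' g] f' assms by fastforce
  moreover have "a + b \<notin> Poly_Mapping.keys (Poly_Mapping.single a (Poly_Mapping.lookup f a) * g')"
    using keys_mult[of "Poly_Mapping.single a (Poly_Mapping.lookup f a)" g'] g'
    by (auto split: if_splits)
  moreover have "f * g = Poly_Mapping.single (a + b) (Poly_Mapping.lookup f a * Poly_Mapping.lookup g b)
      + Poly_Mapping.single a (Poly_Mapping.lookup f a) * g' + f' * g"
    by (simp add: f'_def g'_def mult_single algebra_simps)
  ultimately show ?thesis
    by (simp add: lookup_add in_keys_iff)
qed

lemma keys_singletonD:
  fixes f :: cpoly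
  assumes "Poly_Mapping.keys f = {a}"
  shows "f = Poly_Mapping.single a (Poly_Mapping.lookup f a)"
  using assms by (intro poly_mapping_eqI) (auto simp: lookup_single when_def in_keys_iff)

text \<open>A single term has only single terms as factors. Exponent vectors carry a linear order
  compatible with addition, and for such an order the largest and the smallest exponents of a product
  are the sums of those of the factors. In a single term the two coincide, which forces them to
  coincide in each factor.\<close>

lemma factors_of_single:
  fixes f g :: cpoly
  assumes fg: "f * g = Poly_Mapping.single u c" and c: "c \<noteq> 0"
  obtains v w a b where "f = Poly_Mapping.single v a" "g = Poly_Mapping.single w b"
    "v + w = u" "a * b = c"
proof -
  let ?F = "Poly_Mapping.keys f" and ?G = "Poly_Mapping.keys g"
  have "f * g \<noteq> 0"
    using fg c by (metis lookup_single_eq lookup_zero)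
  then have ne: "?F \<noteq> {}" "?G \<noteq> {}"
    by auto
  have keys_fg: "Poly_Mapping.keys (f * g) = {u}"
    using fg c by simp
  have in_fg: "a + b = u" if "a \<in> ?F" "b \<in> ?G"
    "\<And>a' b'. a' \<in> ?F \<Longrightarrow> b' \<in> ?G \<Longrightarrow> a' + b' = a + b \<Longrightarrow> a' = a" for a b
  proof -
    have "Poly_Mapping.lookup (f * g) (a + b) = Poly_Mapping.lookup f a * Poly_Mapping.lookup g b"
      by (rule lookup_mult_unique_sum) (rule that(3))
    then have "a + b \<in> Poly_Mapping.keys (f * g)"
      using that(1,2) by (simp add: in_keys_iff)
    then show ?thesis
      using keys_fg by simp
  qed
  have max: "Max ?F + Max ?G = u"
  proof (rule in_fg)
    fix a' b' assume "a' \<in> ?F" "b' \<in> ?G" "a' + b' = Max ?F + Max ?G"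
    moreover from this have "a' \<le> Max ?F" "b' \<le> Max ?G"
      by simp_all
    ultimately show "a' = Max ?F"
      by (metis add_less_le_mono less_le)
  qed (use ne in auto)
  have min: "Min ?F + Min ?G = u"
  proof (rule in_fg)
    fix a' b' assume "a' \<in> ?F" "b' \<in> ?G" "a' + b' = Min ?F + Min ?G"
    moreover from this have "Min ?F \<le> a'" "Min ?G \<le> b'"
      by simp_all
    ultimately show "a' = Min ?F"
      by (metis add_less_le_mono less_le)
  qed (use ne in auto)
  have "Min ?F \<le> Max ?F" "Min ?G \<le> Max ?G"
    using ne by auto
  with max min have eq: "Min ?F = Max ?F" "Min ?G = Max ?G"
    by (metis add_less_le_mono less_le, metis add_le_less_mono less_le)
  have singleton: "S = {Max S}" if "finite S" "S \<noteq> {}" "Min S = Max S" for S :: "(nat \<Rightarrow>\<^sub>0 nat) set"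
  proof -
    have "x = Max S" if "x \<in> S" for x
      using Min_le[OF \<open>finite S\<close> that] Max_ge[OF \<open>finite S\<close> that] \<open>Min S = Max S\<close> by simp
    then show ?thesis
      using Max_in[OF that(1,2)] by blast
  qed
  have "?F = {Max ?F}" "?G = {Max ?G}"
    by (rule singleton[OF finite_keys ne(1) eq(1)], rule singleton[OF finite_keys ne(2) eq(2)])
  then have fs: "f = Poly_Mapping.single (Max ?F) (Poly_Mapping.lookup f (Max ?F))"
    and gs: "g = Poly_Mapping.single (Max ?G) (Poly_Mapping.lookup g (Max ?G))"
    by (blast intro: keys_singletonD)+
  have "Poly_Mapping.single u c = Poly_Mapping.single u (Poly_Mapping.lookup f (Max ?F) * Poly_Mapping.lookup g (Max ?G))"
    using fg fs gs max by (metis mult_single)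
  then have "Poly_Mapping.lookup f (Max ?F) * Poly_Mapping.lookup g (Max ?G) = c"
    by (metis lookup_single_eq)
  with fs gs max show ?thesis
    using that by blast
qed

lemma monomial_dvdI:
  fixes p :: cpoly
  assumes "\<And>m k. m \<in> Poly_Mapping.keys p \<Longrightarrow> k \<le> n \<Longrightarrow> e k \<le> Poly_Mapping.lookup m k"
  shows "monomial n e dvd p"
proof -
  have "p = (\<Sum>m\<in>Poly_Mapping.keys p. Poly_Mapping.single m (Poly_Mapping.lookup p m))"
    by (rule poly_mapping_eqI)
      (auto simp: lookup_sum lookup_single when_def sum.delta in_keys_iff intro!: sum.neutral)
  also have "monomial n e dvd \<dots>"
  proof (rule dvd_sum)
    fix m assume m: "m \<in> Poly_Mapping.keys p"
    have "m = exponent_vector n e + (m - exponent_vector n e)"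
      using assms[OF m] by (intro poly_mapping_eqI) (simp add: lookup_add lookup_minus lookup_exponent_vector)
    then have "Poly_Mapping.single m (Poly_Mapping.lookup p m) =
        monomial n e * Poly_Mapping.single (m - exponent_vector n e) (Poly_Mapping.lookup p m)"
      by (metis monomial_eq_single mult_single mult_1)
    then show "monomial n e dvd Poly_Mapping.single m (Poly_Mapping.lookup p m)"
      by simp
  qed
  finally show ?thesis .
qed

lemma keys_monomial_mult:
  "Poly_Mapping.keys (monomial n e * p) = (\<lambda>m. exponent_vector n e + m) ` Poly_Mapping.keys p"
proof -
  have "Poly_Mapping.lookup (monomial n e * p) (exponent_vector n e + m) = Poly_Mapping.lookup p m" for m
    by (subst lookup_mult_unique_sum) (auto simp: monomial_eq_single)
  then have "(\<lambda>m. exponent_vector n e + m) ` Poly_Mapping.keys p \<subseteq> Poly_Mapping.keys (monomial n e * p)"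
    by (auto simp: in_keys_iff)
  moreover have "Poly_Mapping.keys (monomial n e * p) \<subseteq> (\<lambda>m. exponent_vector n e + m) ` Poly_Mapping.keys p"
    using keys_mult[of "monomial n e" p] by (auto simp: monomial_eq_single)
  ultimately show ?thesis by blast
qed

lemma dvd_monomialE:
  assumes "h dvd monomial n e"
  obtains v a where "h = Poly_Mapping.single v a" "a \<noteq> 0"
    "\<And>k. Poly_Mapping.lookup v k \<le> (if k \<le> n then e k else 0)"
proof -
  from assms obtain g where "h * g = Poly_Mapping.single (exponent_vector n e) 1"
    by (metis dvdE monomial_eq_single)
  then obtain v w a b where *: "h = Poly_Mapping.single v a" "v + w = exponent_vector n e" "a * b = 1"
    by (rule factors_of_single) simp
  from \<open>a * b = 1\<close> have "a \<noteq> 0"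
    by auto
  moreover have "Poly_Mapping.lookup v k \<le> (if k \<le> n then e k else 0)" for k
    using arg_cong[OF *(2), of "\<lambda>m. Poly_Mapping.lookup m k"]
    by (simp add: lookup_add lookup_exponent_vector)
  ultimately show ?thesis
    using that *(1) by blast
qed

text \<open>A common divisor is a single term whose exponent in each variable is at most the least
  exponent occurring in the family; so if these minima vanish it is a constant.\<close>

lemma no_common_factor_monomials:
  assumes red: "\<And>k. k \<le> n \<Longrightarrow> \<exists>i\<le>n. w i k = 0"
  shows "no_common_factor n (\<lambda>i. monomial n (w i))"
  unfolding no_common_factor_def
proof (intro allI impI)
  fix h assume h: "\<forall>i\<le>n. h dvd monomial n (w i)"
  then have "h dvd monomial n (w 0)"
    by simp
  then obtain v a where va: "h = Poly_Mapping.single v a" "a \<noteq> 0"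
    and v0: "\<And>k. Poly_Mapping.lookup v k \<le> (if k \<le> n then w 0 k else 0)"
    by (rule dvd_monomialE) blast
  have "Poly_Mapping.lookup v k = 0" for k
  proof (cases "k \<le> n")
    case True
    then obtain i where "i \<le> n" "w i k = 0"
      using red by blast
    with h have "h dvd monomial n (w i)"
      by simp
    then obtain v' a' where va': "h = Poly_Mapping.single v' a'" "a' \<noteq> 0"
      and "\<And>k. Poly_Mapping.lookup v' k \<le> (if k \<le> n then w i k else 0)"
      by (rule dvd_monomialE) blast
    from this(3)[of k] True \<open>w i k = 0\<close> have "Poly_Mapping.lookup v' k = 0"
      by simp
    moreover have "Poly_Mapping.keys h = {v}"
      using va by simp
    moreover have "Poly_Mapping.keys h = {v'}"
      using va' by simp
    ultimately show ?thesis
      by simp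
  next
    case False
    then show ?thesis
      using v0[of k] by simp
  qed
  then have "v = 0"
    by (intro poly_mapping_eqI) simp
  then have "h * Poly_Mapping.single 0 (1 / a) = 1"
    using va by (simp add: mult_single)
  then show "h dvd 1"
    by (metis dvdI)
qed

text \<open>The degree of a map given by monomials can be read off as soon as every variable is absent from
  one of them. What needs proof is that every other tuple \<open>p\<close> without common factors that represents
  the map has the same degree. Factorization into primes would give \<open>p\<close> proportional to the monomials
  \<open>q i\<close>, but here the relation \<open>q i * p j = q j * p i\<close> suffices: for each variable choose \<open>j\<close> such that
  it is absent from \<open>q j\<close>; then its exponents in \<open>p i\<close> are at least that in \<open>q i\<close>. Hence
  \<open>q i\<close> divides \<open>p i\<close>, the quotient does not depend on \<open>i\<close>, and being a common factor it is constant.\<close>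

lemma rat_map_degree_monomials:
  assumes red: "\<And>k. k \<le> n \<Longrightarrow> \<exists>i\<le>n. w i k = 0"
    and sum: "\<And>i. i \<le> n \<Longrightarrow> (\<Sum>k\<le>n. w i k) = d"
    and f: "\<And>i. i \<le> n \<Longrightarrow> f i = h * monomial n (w i)"
    and h: "h \<noteq> 0"
  shows "rat_map_degree n f = d"
  unfolding rat_map_degree_def
proof (rule the_equality)
  let ?q = "\<lambda>i. monomial n (w i)"
  have "rat_map_tuple n d ?q"
    using sum by (auto simp: rat_map_tuple_def homogeneous_monomial monomial_nonzero)
  moreover have "no_common_factor n ?q"
    using red by (rule no_common_factor_monomials)
  moreover have "same_rat_map n f ?q"
    by (simp add: same_rat_map_def f mult_ac)
  ultimately show "\<exists>p. rat_map_tuple n d p \<and> no_common_factor n p \<and> same_rat_map n f p"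
    by blast
  fix d' assume "\<exists>p. rat_map_tuple n d' p \<and> no_common_factor n p \<and> same_rat_map n f p"
  then obtain p where hom: "rat_map_tuple n d' p" and ncf: "no_common_factor n p"
    and same: "same_rat_map n f p"
    by blast
  have cross: "?q i * p j = ?q j * p i" if "i \<le> n" "j \<le> n" for i j
  proof -
    have "h * (?q i * p j) = h * (?q j * p i)"
      using same that by (simp add: same_rat_map_def f mult_ac)
    then show ?thesis
      using h by simp
  qed
  have "?q 0 dvd p 0"
  proof (rule monomial_dvdI)
    fix m k assume m: "m \<in> Poly_Mapping.keys (p 0)" and k: "k \<le> n"
    from red[OF k] obtain j where j: "j \<le> n" "w j k = 0"
      by blast
    have "exponent_vector n (w j) + m \<in> Poly_Mapping.keys (?q j * p 0)"
      using m by (simp add: keys_monomial_mult)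
    also have "?q j * p 0 = ?q 0 * p j"
      using cross[of j 0] j by simp
    finally obtain m' where "exponent_vector n (w j) + m = exponent_vector n (w 0) + m'"
      by (auto simp: keys_monomial_mult)
    from arg_cong[OF this, of "\<lambda>m. Poly_Mapping.lookup m k"] show "w 0 k \<le> Poly_Mapping.lookup m k"
      using j k by (simp add: lookup_add lookup_exponent_vector)
  qed
  then obtain r where p0: "p 0 = ?q 0 * r"
    by (rule dvdE)
  have "r dvd p i" if "i \<le> n" for i
  proof -
    have "?q 0 * p i = ?q 0 * (?q i * r)"
      using cross[of 0 i] that by (simp add: p0 mult_ac)
    then have "p i = ?q i * r"
      by (simp add: monomial_nonzero)
    then show ?thesis
      by simp
  qed
  with ncf have "r dvd 1"
    by (auto simp: no_common_factor_def)
  then have "r dvd monomial n (\<lambda>k. 0)"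
    by (simp add: monomial_def)
  then obtain v a where r: "r = Poly_Mapping.single v a" "a \<noteq> 0"
    and v: "\<And>k. Poly_Mapping.lookup v k \<le> (if k \<le> n then 0 else 0)"
    by (rule dvd_monomialE) blast
  have "v = 0"
    using v by (intro poly_mapping_eqI) (simp split: if_splits)
  with r p0 have "Poly_Mapping.keys (p 0) = {exponent_vector n (w 0)}"
    by (simp add: monomial_eq_single mult_single)
  moreover have "homogeneous n d' (p 0)"
    using hom by (simp add: rat_map_tuple_def)
  ultimately have "(\<Sum>k\<le>n. w 0 k) = d'"
    by (simp add: homogeneous_def lookup_exponent_vector)
  then show "d' = d"
    using sum[of 0] by simp
qed

section \<open>Iterates and degrees of monomial maps\<close>

lemma sum_laurent_exponent: "(\<Sum>k\<le>n. laurent_exponent n B i k) = 0"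
  by (simp add: lessThan_Suc_atMost[symmetric] laurent_exponent_def)

text \<open>The projective exponent matrix is multiplicative. The last row vanishes, which cuts the sum over
  \<open>k\<close> down to \<open>k < n\<close>, and the last column is a fixed linear function of the others.\<close>

lemma laurent_exponent_mult:
  assumes A: "A \<in> carrier_mat n n" and B: "B \<in> carrier_mat n n" and "i \<le> n" "j \<le> n"
  shows "laurent_exponent n (A * B) i j =
    (\<Sum>k\<le>n. laurent_exponent n A i k * laurent_exponent n B k j)"
proof (cases "i = n")
  case True
  then show ?thesis by (simp add: laurent_exponent_def)
next
  case False
  with \<open>i \<le> n\<close> have i: "i < n" by simp
  have AB: "(A * B) $$ (i, l) = (\<Sum>k<n. A $$ (i, k) * B $$ (k, l))" if "l < n" for l
    using A B i that by (simp add: scalar_prod_def atLeast0LessThan)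
  have "(\<Sum>k\<le>n. laurent_exponent n A i k * laurent_exponent n B k j) =
      (\<Sum>k<n. A $$ (i, k) * laurent_exponent n B k j)"
    using i by (simp add: lessThan_Suc_atMost[symmetric] laurent_exponent_def)
  also have "\<dots> = laurent_exponent n (A * B) i j"
  proof (cases "j = n")
    case True
    have "(\<Sum>k<n. A $$ (i, k) * laurent_exponent n B k j) =
        - (\<Sum>k<n. \<Sum>l<n. A $$ (i, k) * B $$ (k, l))"
      using True by (simp add: laurent_exponent_def sum_distrib_left sum_negf)
    also have "\<dots> = - (\<Sum>l<n. (A * B) $$ (i, l))"
      by (subst sum.swap) (simp add: AB)
    finally show ?thesis
      using True i by (simp add: laurent_exponent_def)
  next
    case False
    then show ?thesis
      using \<open>j \<le> n\<close> i AB[of j] by (simp add: laurent_exponent_def)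
  qed
  finally show ?thesis ..
qed

definition least_exponent :: "nat \<Rightarrow> int mat \<Rightarrow> nat \<Rightarrow> int" where
  "least_exponent n B k = Min ((\<lambda>i. laurent_exponent n B i k) ` {..n})"

lemma least_exponent_le: "i \<le> n \<Longrightarrow> least_exponent n B k \<le> laurent_exponent n B i k"
  by (simp add: least_exponent_def)

lemma least_exponent_attained: "\<exists>i\<le>n. laurent_exponent n B i k = least_exponent n B k"
proof -
  have "least_exponent n B k \<in> (\<lambda>i. laurent_exponent n B i k) ` {..n}"
    unfolding least_exponent_def by (rule Min_in) auto
  then show ?thesis by auto
qed

lemma least_exponent_nonpos: "least_exponent n B k \<le> 0"
  using least_exponent_le[of n n B k] by (simp add: laurent_exponent_def)

lemma monomial_map_eq:
  "monomial_map n A i = monomial n (\<lambda>k. nat (laurent_exponent n A i k - least_exponent n A k))"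
  by (simp add: monomial_map_def monomial_def least_exponent_def)

lemma prod_power_monomials:
  "(\<Prod>k\<le>n. monomial n (e k) ^ c k) = monomial n (\<lambda>j. \<Sum>k\<le>n. e k j * c k)"
  unfolding monomial_def
  by (simp add: prod_power_distrib power_mult[symmetric] power_sum) (rule prod.swap)

lemma pow_mat_Suc_left:
  assumes "(A :: 'a :: semiring_1 mat) \<in> carrier_mat n n"
  shows "A ^\<^sub>m Suc N = A * A ^\<^sub>m N"
proof (induction N)
  case 0
  then show ?case using assms by auto
next
  case (Suc N)
  have "A ^\<^sub>m Suc (Suc N) = A ^\<^sub>m Suc N * A"
    by simp
  also have "\<dots> = A * A ^\<^sub>m N * A"
    by (simp only: Suc)
  also have "\<dots> = A * A ^\<^sub>m Suc N"
    using assms by (simp add: assoc_mult_mat[of _ n n _ n _ n])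
  finally show ?case .
qed

text \<open>Substituting monomials into monomials multiplies exponent matrices. The tuples are not reduced
  along the way, so the exponents of the \<open>N\<close>-th iterate are the Laurent exponents of the \<open>N\<close>-th
  power of \<open>A\<close> only up to a vector \<open>c\<close> common to all coordinates. Such shifts stay common
  to all coordinates in the next iterate: the minima subtracted from the exponents of \<open>A\<close> are the same
  in each row, and the Laurent exponents in each row sum to zero, so that \<open>c\<close> enters only
  through those minima.\<close>

lemma monomial_map_iterate:
  assumes A: "A \<in> carrier_mat n n"
  shows "\<exists>c. \<forall>i\<le>n. (\<forall>k\<le>n. 0 \<le> laurent_exponent n (A ^\<^sub>m N) i k + c k) \<and>
    rat_map_iterate (monomial_map n A) N i =
      monomial n (\<lambda>k. nat (laurent_exponent n (A ^\<^sub>m N) i k + c k))"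
proof (induction N)
  case 0
  \<comment> \<open>The identity is \<open>(x\<^sub>1/x\<^sub>n\<^sub>+\<^sub>1 : \<dots> : 1)\<close> multiplied by the coordinate at infinity.\<close>
  let ?c = "\<lambda>k. if k = n then 1 else 0 :: int"
  have L: "laurent_exponent n (A ^\<^sub>m 0) i k + ?c k = (if k = i then 1 else 0)"
    if "i \<le> n" "k \<le> n" for i k
    using A that by (auto simp: laurent_exponent_def)
  have "rat_map_iterate (monomial_map n A) 0 i =
      monomial n (\<lambda>k. nat (laurent_exponent n (A ^\<^sub>m 0) i k + ?c k))" if "i \<le> n" for i
  proof -
    have "monomial n (\<lambda>k. nat (laurent_exponent n (A ^\<^sub>m 0) i k + ?c k)) =
        monomial n (\<lambda>k. if k = i then 1 else 0)"
      by (rule monomial_cong) (simp only: L[OF that] split: if_splits, simp)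
    also have "\<dots> = (\<Prod>k\<le>n. if k = i then var_poly k else 1)"
      unfolding monomial_def by (rule prod.cong) auto
    also have "\<dots> = var_poly i"
      using that by simp
    finally show ?thesis
      by simp
  qed
  moreover have "0 \<le> laurent_exponent n (A ^\<^sub>m 0) i k + ?c k" if "i \<le> n" "k \<le> n" for i k
    using L[OF that] by presburger
  ultimately show ?case
    by (intro exI[of _ ?c]) blast
next
  case (Suc N)
  let ?L = "laurent_exponent n A" and ?LN = "laurent_exponent n (A ^\<^sub>m N)"
    and ?M = "least_exponent n A"
  from Suc obtain c where
    nonneg: "\<And>i k. i \<le> n \<Longrightarrow> k \<le> n \<Longrightarrow> 0 \<le> ?LN i k + c k" and
    iter: "\<And>i. i \<le> n \<Longrightarrow> rat_map_iterate (monomial_map n A) N i = monomial n (\<lambda>k. nat (?LN i k + c k))"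
    by blast
  define c' where "c' j = - (\<Sum>k\<le>n. ?M k * (?LN k j + c j))" for j
  have step: "(0 \<le> laurent_exponent n (A ^\<^sub>m Suc N) i j + c' j) \<and>
      (\<Sum>k\<le>n. nat (?LN k j + c j) * nat (?L i k - ?M k)) =
        nat (laurent_exponent n (A ^\<^sub>m Suc N) i j + c' j)"
    if "i \<le> n" "j \<le> n" for i j
  proof -
    have "int (\<Sum>k\<le>n. nat (?LN k j + c j) * nat (?L i k - ?M k)) =
        (\<Sum>k\<le>n. (?LN k j + c j) * (?L i k - ?M k))"
      using that by (simp add: nonneg least_exponent_le)
    also have "\<dots> = (\<Sum>k\<le>n. ?L i k * ?LN k j) + (\<Sum>k\<le>n. ?L i k) * c j
        - (\<Sum>k\<le>n. ?M k * (?LN k j + c j))"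
      unfolding sum_distrib_right sum.distrib[symmetric] sum_subtractf[symmetric]
      by (intro sum.cong) (simp_all add: algebra_simps)
    also have "\<dots> = laurent_exponent n (A ^\<^sub>m Suc N) i j + c' j"
      using A that
      by (simp only: pow_mat_Suc_left[OF A] laurent_exponent_mult[OF A pow_carrier_mat[OF A]]
        sum_laurent_exponent c'_def)
    finally show ?thesis
      by linarith
  qed
  have "rat_map_iterate (monomial_map n A) (Suc N) i =
      monomial n (\<lambda>j. nat (laurent_exponent n (A ^\<^sub>m Suc N) i j + c' j))" if "i \<le> n" for i
  proof -
    have "rat_map_iterate (monomial_map n A) (Suc N) i =
        (\<Prod>k\<le>n. rat_map_iterate (monomial_map n A) N k ^ nat (?L i k - ?M k))"
      by (simp add: rat_map_comp_def monomial_map_eq monomial_def subst_poly_prod_var)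
    also have "\<dots> = (\<Prod>k\<le>n. monomial n (\<lambda>j. nat (?LN k j + c j)) ^ nat (?L i k - ?M k))"
      by (simp add: iter)
    also have "\<dots> = monomial n (\<lambda>j. nat (laurent_exponent n (A ^\<^sub>m Suc N) i j + c' j))"
      unfolding prod_power_monomials using step that by (intro monomial_cong) blast
    finally show ?thesis .
  qed
  with step show ?case
    by (intro exI[of _ c']) blast
qed

text \<open>Every coordinate of the reduced tuple has this degree, because its Laurent exponents sum to zero
  and only the subtracted minima remain.\<close>

definition monomial_map_degree :: "nat \<Rightarrow> int mat \<Rightarrow> int" where
  "monomial_map_degree n B = (\<Sum>k\<le>n. - least_exponent n B k)"

lemma rat_map_degree_monomial_map_iterate:
  assumes A: "A \<in> carrier_mat n n"
  shows "int (rat_map_degree n (rat_map_iterate (monomial_map n A) N)) = monomial_map_degree n (A ^\<^sub>m N)"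
proof -
  let ?L = "laurent_exponent n (A ^\<^sub>m N)" and ?M = "least_exponent n (A ^\<^sub>m N)"
  obtain c where
    nonneg: "\<And>i k. i \<le> n \<Longrightarrow> k \<le> n \<Longrightarrow> 0 \<le> ?L i k + c k" and
    iter: "\<And>i. i \<le> n \<Longrightarrow> rat_map_iterate (monomial_map n A) N i = monomial n (\<lambda>k. nat (?L i k + c k))"
    using monomial_map_iterate[OF A] by blast
  have M: "0 \<le> ?M k + c k" if "k \<le> n" for k
    using least_exponent_attained[of n "A ^\<^sub>m N" k] nonneg[OF _ that] by metis
  have "rat_map_degree n (rat_map_iterate (monomial_map n A) N) = nat (monomial_map_degree n (A ^\<^sub>m N))"
  proof (rule rat_map_degree_monomials)
    fix k
    show "\<exists>i\<le>n. nat (?L i k - ?M k) = 0"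
      using least_exponent_attained[of n "A ^\<^sub>m N" k] by auto
  next
    fix i assume i: "i \<le> n"
    have "int (\<Sum>k\<le>n. nat (?L i k - ?M k)) = (\<Sum>k\<le>n. ?L i k - ?M k)"
      by (simp add: least_exponent_le[OF i])
    also have "\<dots> = monomial_map_degree n (A ^\<^sub>m N)"
      by (simp add: sum_subtractf sum_laurent_exponent monomial_map_degree_def sum_negf)
    finally show "(\<Sum>k\<le>n. nat (?L i k - ?M k)) = nat (monomial_map_degree n (A ^\<^sub>m N))"
      by linarith
    show "rat_map_iterate (monomial_map n A) N i =
        monomial n (\<lambda>k. nat (?M k + c k)) * monomial n (\<lambda>k. nat (?L i k - ?M k))"
      unfolding iter[OF i] monomial_mult
    proof (rule monomial_cong)
      fix k assume "k \<le> n"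
      then show "nat (?L i k + c k) = nat (?M k + c k) + nat (?L i k - ?M k)"
        using M[of k] least_exponent_le[OF i, of "A ^\<^sub>m N" k] by linarith
    qed
  qed (rule monomial_nonzero)
  moreover have "0 \<le> monomial_map_degree n (A ^\<^sub>m N)"
    unfolding monomial_map_degree_def by (rule sum_nonneg) (simp add: least_exponent_nonpos)
  ultimately show ?thesis
    by simp
qed

text \<open>The degree visibly bounds the negative exponents. It also bounds the positive ones, since in a row
  that sums to zero a positive entry is balanced by negative ones.\<close>

lemma abs_laurent_exponent_le_degree:
  assumes "i \<le> n" "j \<le> n"
  shows "\<bar>laurent_exponent n B i j\<bar> \<le> monomial_map_degree n B"
proof -
  let ?L = "laurent_exponent n B i" and ?M = "least_exponent n B"
  have D: "monomial_map_degree n B = - ?M j + (\<Sum>k\<in>{..n} - {j}. - ?M k)"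
    unfolding monomial_map_degree_def using assms by (simp add: sum.remove[of "{..n}" j])
  have rest: "0 \<le> (\<Sum>k\<in>{..n} - {j}. - ?M k)"
    by (rule sum_nonneg) (simp add: least_exponent_nonpos)
  have "?L j + (\<Sum>k\<in>{..n} - {j}. ?L k) = 0"
    using sum_laurent_exponent[where B = B and i = i and n = n] assms
    by (simp add: sum.remove[of "{..n}" j])
  then have "?L j = (\<Sum>k\<in>{..n} - {j}. - ?L k)"
    by (simp add: sum_negf)
  also have "\<dots> \<le> (\<Sum>k\<in>{..n} - {j}. - ?M k)"
    by (rule sum_mono) (simp add: least_exponent_le[OF \<open>i \<le> n\<close>])
  finally show ?thesis
    using D rest least_exponent_le[OF \<open>i \<le> n\<close>, of B j] least_exponent_nonpos[of n B j] by linarith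
qed

lemma monomial_map_degree_le:
  fixes b :: real
  assumes b: "\<And>i j. i < n \<Longrightarrow> j < n \<Longrightarrow> \<bar>of_int (B $$ (i, j))\<bar> \<le> b" and "n > 0"
  shows "of_int (monomial_map_degree n B) \<le> real (n + 1) * (real n * b)"
proof -
  have "0 \<le> b"
    using b[of 0 0] \<open>n > 0\<close> by linarith
  then have nb: "0 \<le> real n * b" "b \<le> real n * b"
    using \<open>n > 0\<close> by (simp_all add: mult_le_cancel_right1)
  have L: "\<bar>real_of_int (laurent_exponent n B i k)\<bar> \<le> real n * b" if "i \<le> n" "k \<le> n" for i k
  proof -
    have "\<bar>\<Sum>j<n. real_of_int (B $$ (i, j))\<bar> \<le> real n * b" if "i < n"
    proof -
      have "\<bar>\<Sum>j<n. real_of_int (B $$ (i, j))\<bar> \<le> (\<Sum>j<n. \<bar>real_of_int (B $$ (i, j))\<bar>)"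
        by (rule sum_abs)
      also have "\<dots> \<le> (\<Sum>j<n. b)"
        using b that by (intro sum_mono) auto
      finally show ?thesis by simp
    qed
    moreover have "\<bar>real_of_int (B $$ (i, k))\<bar> \<le> real n * b" if "i < n" "k < n"
      using b[OF that] nb by linarith
    ultimately show ?thesis
      using that nb by (auto simp: laurent_exponent_def)
  qed
  have "real_of_int (monomial_map_degree n B) = (\<Sum>k\<le>n. - real_of_int (least_exponent n B k))"
    by (simp add: monomial_map_degree_def)
  also have "\<dots> \<le> (\<Sum>k\<le>n. real n * b)"
  proof (rule sum_mono)
    fix k assume "k \<in> {..n}"
    with least_exponent_attained[of n B k] L show "- real_of_int (least_exponent n B k) \<le> real n * b"
      by (metis abs_le_D2 atMost_iff)
  qed
  finally show ?thesis by simp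
qed

section \<open>Growth of matrix powers\<close>

text \<open>Apply the power to an eigenvector for an eigenvalue of maximal modulus and compare the entries of
  largest modulus.\<close>

lemma spectral_radius_pow_le:
  assumes C: "C \<in> carrier_mat n n" and n: "n > 0" and b: "norm_bound (C ^\<^sub>m N) b"
  shows "spectral_radius C ^ N \<le> real n * b"
proof -
  obtain x where x: "x \<in> spectrum C" "norm x = spectral_radius C"
    using spectral_radius_mem_max(1)[OF C n] by auto
  then obtain v where v: "eigenvector C v x"
    by (auto simp: spectrum_def eigenvalue_def)
  then have dim: "dim_vec v = n" and ne: "v \<noteq> 0\<^sub>v n"
    using C by (auto simp: eigenvector_def)
  define m where "m = Max ((\<lambda>i. norm (v $ i)) ` {..<n})"
  have "m \<in> (\<lambda>i. norm (v $ i)) ` {..<n}"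
    unfolding m_def using n by (intro Max_in) auto
  then obtain i where i: "i < n" "norm (v $ i) = m"
    by auto
  have le_m: "norm (v $ j) \<le> m" if "j < n" for j
    unfolding m_def using that by (intro Max_ge) auto
  have "m \<noteq> 0"
  proof
    assume "m = 0"
    then have "v = 0\<^sub>v n"
      using le_m dim by (intro eq_vecI) auto
    with ne show False ..
  qed
  then have "m > 0"
    using i by (metis norm_ge_zero order_le_less)
  have "x ^ N * v $ i = (C ^\<^sub>m N *\<^sub>v v) $ i"
    using eigenvector_pow[OF C v, of N] i dim by simp
  also have "\<dots> = (\<Sum>j<n. (C ^\<^sub>m N) $$ (i, j) * v $ j)"
    using i dim C by (simp add: scalar_prod_def atLeast0LessThan)
  finally have "norm x ^ N * m = norm (\<Sum>j<n. (C ^\<^sub>m N) $$ (i, j) * v $ j)"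
    using i by (metis norm_mult norm_power)
  also have "\<dots> \<le> (\<Sum>j<n. b * m)"
  proof (rule sum_norm_le)
    fix j assume "j \<in> {..<n}"
    moreover from this have "norm ((C ^\<^sub>m N) $$ (i, j)) \<le> b"
      using b i C by (simp add: norm_bound_def)
    ultimately show "norm ((C ^\<^sub>m N) $$ (i, j) * v $ j) \<le> b * m"
      unfolding norm_mult using le_m by (intro mult_mono) (auto intro: order_trans[OF norm_ge_zero])
  qed
  also have "\<dots> = (real n * b) * m"
    by simp
  finally show ?thesis
    using \<open>m > 0\<close> x by simp
qed

lemma smult_pow_mat:
  assumes "(C :: 'a :: comm_ring_1 mat) \<in> carrier_mat n n"
  shows "(s \<cdot>\<^sub>m C) ^\<^sub>m N = s ^ N \<cdot>\<^sub>m C ^\<^sub>m N"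
proof (induction N)
  case 0
  then show ?case by (intro eq_matI) auto
next
  case (Suc N)
  have "(s \<cdot>\<^sub>m C) ^\<^sub>m Suc N = (s ^ N \<cdot>\<^sub>m C ^\<^sub>m N) * (s \<cdot>\<^sub>m C)"
    by (simp add: Suc)
  also have "\<dots> = s ^ Suc N \<cdot>\<^sub>m (C ^\<^sub>m N * C)"
    using assms by (intro eq_matI) (auto simp: mult_ac)
  finally show ?case by simp
qed

text \<open>Rescaling by \<open>1 / r\<close> brings the spectral radius below 1, where the powers are bounded by
  the Jordan normal form.\<close>

lemma norm_bound_pow_mat:
  assumes C: "C \<in> carrier_mat n n" and n: "n > 0" and r: "spectral_radius C < r" "r > 0"
  shows "\<exists>c. \<forall>N. norm_bound (C ^\<^sub>m N) (c * r ^ N)"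
proof -
  define s where "s = complex_of_real (1 / r)"
  have s: "s \<noteq> 0" "norm s = 1 / r"
    using r by (auto simp: s_def norm_divide)
  have sC: "s \<cdot>\<^sub>m C \<in> carrier_mat n n"
    using C by simp
  obtain y where y: "y \<in> spectrum (s \<cdot>\<^sub>m C)" "norm y = spectral_radius (s \<cdot>\<^sub>m C)"
    using spectral_radius_mem_max(1)[OF sC n] by auto
  then obtain v where v: "v \<in> carrier_vec n" "v \<noteq> 0\<^sub>v n" "(s \<cdot>\<^sub>m C) *\<^sub>v v = y \<cdot>\<^sub>v v"
    using C by (auto simp: spectrum_def eigenvalue_def eigenvector_def)
  have "C *\<^sub>v v = (y / s) \<cdot>\<^sub>v v"
  proof (rule eq_vecI)
    fix i assume "i < dim_vec ((y / s) \<cdot>\<^sub>v v)"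
    then have i: "i < n"
      using v by simp
    have "s * (C *\<^sub>v v) $ i = ((s \<cdot>\<^sub>m C) *\<^sub>v v) $ i"
      using C i v(1) by (simp add: scalar_prod_def sum_distrib_left mult_ac)
    also have "\<dots> = y * v $ i"
      using i v by simp
    finally show "(C *\<^sub>v v) $ i = ((y / s) \<cdot>\<^sub>v v) $ i"
      using i v(1) s by (simp add: field_simps)
  qed (use C v in auto)
  then have "y / s \<in> spectrum C"
    using v C by (auto simp: spectrum_def eigenvalue_def eigenvector_def)
  then have "norm (y / s) \<le> spectral_radius C"
    using spectral_radius_mem_max(2)[OF C n] by blast
  then have "norm y * r \<le> spectral_radius C"
    by (simp add: norm_divide s)
  with r have "norm y * r < 1 * r"
    by linarith
  then have "spectral_radius (s \<cdot>\<^sub>m C) < 1"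
    using r(2) y(2) by (simp only: mult_less_cancel_right_pos)
  from spectral_radius_jnf_norm_bound_less_1_upper_triangular[OF sC this]
  obtain c where c: "\<And>N. norm_bound ((s \<cdot>\<^sub>m C) ^\<^sub>m N) c"
    by blast
  have "norm_bound (C ^\<^sub>m N) (c * r ^ N)" for N
  proof (rule norm_boundI)
    fix i j assume ij: "i < dim_row (C ^\<^sub>m N)" "j < dim_col (C ^\<^sub>m N)"
    then have "norm ((s ^ N \<cdot>\<^sub>m C ^\<^sub>m N) $$ (i, j)) \<le> c"
      using c[of N] C unfolding smult_pow_mat[OF C] norm_bound_def by simp
    with ij have "norm ((C ^\<^sub>m N) $$ (i, j)) / r ^ N \<le> c"
      by (simp add: norm_mult norm_power s power_one_over)
    then show "norm ((C ^\<^sub>m N) $$ (i, j)) \<le> c * r ^ N"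
      using r by (simp add: pos_divide_le_eq)
  qed
  then show ?thesis by blast
qed

lemma spectral_radius_pos:
  assumes C: "C \<in> carrier_mat n n" and n: "n > 0" and det: "det C \<noteq> 0"
  shows "spectral_radius C > 0"
proof -
  obtain x where x: "x \<in> spectrum C" "norm x = spectral_radius C"
    using spectral_radius_mem_max(1)[OF C n] by auto
  then obtain v where v: "v \<in> carrier_vec n" "v \<noteq> 0\<^sub>v n" "C *\<^sub>v v = x \<cdot>\<^sub>v v"
    using C by (auto simp: spectrum_def eigenvalue_def eigenvector_def)
  have "x \<noteq> 0"
  proof
    assume "x = 0"
    with v have "C *\<^sub>v v = 0\<^sub>v n"
      by auto
    with v det show False
      using det_0_iff_vec_prod_zero_field[OF C] by blast
  qed
  with x(2) show ?thesis
    by (metis zero_less_norm_iff)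
qed

text \<open>Constant factors do not affect the exponential growth rate. The upper bound is asked for only with
  bases larger than \<open>\<rho>\<close>, because Jordan blocks may add polynomial factors to \<open>\<rho> ^ N\<close>.\<close>

lemma exponential_growth_rate:
  fixes D :: "nat \<Rightarrow> real"
  assumes \<rho>: "\<rho> > 0" and c: "c > 0"
    and lower: "\<And>N. \<rho> ^ N \<le> c * D N"
    and upper: "\<And>r. r > \<rho> \<Longrightarrow> \<exists>K. \<forall>N. D N \<le> K * r ^ N"
  shows "(\<lambda>N. 1 / real N * ln (D N)) \<longlonglongrightarrow> ln \<rho>"
proof -
  have lim: "(\<lambda>N. a + b / real N) \<longlonglongrightarrow> a" for a b :: real
    using tendsto_add[OF tendsto_const lim_const_over_n, of a b] by simp
  have D_pos: "D N > 0" for N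
    using lower[of N] c \<rho> by (metis less_le_trans zero_less_mult_pos zero_less_power)
  show ?thesis
  proof (rule order_tendstoI)
    fix a assume "a < ln \<rho>"
    then have "eventually (\<lambda>N. a < ln \<rho> + (- ln c) / real N) sequentially"
      by (rule order_tendstoD(1)[OF lim])
    then show "eventually (\<lambda>N. a < 1 / real N * ln (D N)) sequentially"
      using eventually_gt_at_top[of 0]
    proof eventually_elim
      case (elim N)
      have "real N * ln \<rho> = ln (\<rho> ^ N)"
        using \<rho> by (simp add: ln_realpow)
      also have "\<dots> \<le> ln (c * D N)"
        using lower[of N] \<rho> by (intro ln_mono) auto
      also have "\<dots> = ln c + ln (D N)"
        using c D_pos[of N] by (simp add: ln_mult)
      finally have "(real N * ln \<rho> - ln c) / real N \<le> ln (D N) / real N"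
        by (intro divide_right_mono) auto
      then have "ln \<rho> + (- ln c) / real N \<le> 1 / real N * ln (D N)"
        using elim by (simp add: diff_divide_distrib)
      with elim show ?case by linarith
    qed
  next
    fix b assume b: "ln \<rho> < b"
    \<comment> \<open>Any \<open>r\<close> strictly between \<open>\<rho>\<close> and \<open>exp b\<close> serves.\<close>
    define r where "r = exp ((ln \<rho> + b) / 2)"
    have r: "ln r < b" "r > \<rho>" "r > 0"
      using b \<rho> exp_less_mono[of "ln \<rho>" "(ln \<rho> + b) / 2"] by (simp_all add: r_def)
    from upper[OF r(2)] obtain K where K: "\<And>N. D N \<le> K * r ^ N"
      by blast
    have "K > 0"
      using K[of 0] D_pos[of 0] by simp
    have "eventually (\<lambda>N. ln r + ln K / real N < b) sequentially"
      by (rule order_tendstoD(2)[OF lim r(1)])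
    then show "eventually (\<lambda>N. 1 / real N * ln (D N) < b) sequentially"
      using eventually_gt_at_top[of 0]
    proof eventually_elim
      case (elim N)
      have "ln (D N) \<le> ln (K * r ^ N)"
        using K D_pos by (intro ln_mono) auto
      also have "\<dots> = ln K + real N * ln r"
        using \<open>K > 0\<close> r(3) by (simp add: ln_mult ln_realpow)
      finally have "ln (D N) / real N \<le> (ln K + real N * ln r) / real N"
        by (intro divide_right_mono) auto
      then have "1 / real N * ln (D N) \<le> ln r + ln K / real N"
        using elim by (simp add: add_divide_distrib)
      with elim show ?case by linarith
    qed
  qed
qed

section \<open>Entropy\<close>

theorem theorem6p2:
  fixes A :: "int mat" and n :: nat
  assumes "n > 0"
    and "A \<in> carrier_mat n n"
    and "det A \<noteq> 0"
  shows "convergent (entropy_seq n (monomial_map n A))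
    \<and> algebraic_entropy n (monomial_map n A)
        = ln (spectral_radius (map_mat complex_of_int A))"
proof -
  note n = assms(1) and A = assms(2)
  define C where "C = map_mat complex_of_int A"
  define D where "D N = real_of_int (monomial_map_degree n (A ^\<^sub>m N))" for N
  have C: "C \<in> carrier_mat n n"
    using A by (simp add: C_def)
  have "det C \<noteq> 0"
    using assms(3) by (simp add: C_def of_int_hom.hom_det)
  then have pos: "spectral_radius C > 0"
    by (rule spectral_radius_pos[OF C n])
  have entry: "norm ((C ^\<^sub>m N) $$ (i, j)) = \<bar>real_of_int ((A ^\<^sub>m N) $$ (i, j))\<bar>"
    if "i < n" "j < n" for N i j
    using that A by (simp add: C_def of_int_hom.mat_hom_pow[OF A, symmetric])
  have lower: "spectral_radius C ^ N \<le> real n * D N" for N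
  proof (rule spectral_radius_pow_le[OF C n], rule norm_boundI)
    fix i j assume "i < dim_row (C ^\<^sub>m N)" "j < dim_col (C ^\<^sub>m N)"
    then have ij: "i < n" "j < n"
      by (simp_all only: pow_mat_dim_square[OF C])
    then have "\<bar>(A ^\<^sub>m N) $$ (i, j)\<bar> \<le> monomial_map_degree n (A ^\<^sub>m N)"
      using abs_laurent_exponent_le_degree[of i n j "A ^\<^sub>m N"] by (simp add: laurent_exponent_def)
    then show "norm ((C ^\<^sub>m N) $$ (i, j)) \<le> D N"
      unfolding entry[OF ij] D_def by linarith
  qed
  have upper: "\<exists>K. \<forall>N. D N \<le> K * r ^ N" if r: "r > spectral_radius C" for r
  proof -
    obtain c where c: "\<And>N. norm_bound (C ^\<^sub>m N) (c * r ^ N)"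
      using norm_bound_pow_mat[OF C n r] pos r by auto
    have "D N \<le> (real (n + 1) * real n * c) * r ^ N" for N
    proof -
      have "D N \<le> real (n + 1) * (real n * (c * r ^ N))"
        unfolding D_def
      proof (rule monomial_map_degree_le[OF _ n])
        fix i j assume ij: "i < n" "j < n"
        then have "norm ((C ^\<^sub>m N) $$ (i, j)) \<le> c * r ^ N"
          using c[of N] unfolding norm_bound_def pow_mat_dim_square[OF C] by blast
        then show "\<bar>real_of_int ((A ^\<^sub>m N) $$ (i, j))\<bar> \<le> c * r ^ N"
          unfolding entry[OF ij] .
      qed
      then show ?thesis
        by (simp only: mult.assoc)
    qed
    then show ?thesis by blast
  qed
  have "real (rat_map_degree n (rat_map_iterate (monomial_map n A) N)) = D N" for N
    unfolding D_def by (simp only: of_int_of_nat_eq flip: rat_map_degree_monomial_map_iterate[OF A])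
  then have "entropy_seq n (monomial_map n A) = (\<lambda>N. 1 / real N * ln (D N))"
    by (simp add: entropy_seq_def fun_eq_iff)
  then have "entropy_seq n (monomial_map n A) \<longlonglongrightarrow> ln (spectral_radius C)"
    using exponential_growth_rate[OF pos _ lower upper] n by simp
  then show ?thesis
    unfolding algebraic_entropy_def C_def using convergentI limI by blast
qed

end
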